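(* Let $X$ and $Y$ be real or complex Banach spaces, not necessarily over the same field, and let $C$ be a closed, not necessarily proper, cone in $Y$. Let $T:C\to X$ be a surjective continuous additive positively homogeneous map. Furthermore, let $J$ be a finite set, possibly empty, and, for all $j\in J$, let $\rho_{j}:C\to\mathbb{R}$ be a continuous subadditive positively homogeneous map. Let $S_X:=\{x\in X:\|x\|=1\}$ and $S_Y:=\{y\in Y:\|y\|=1\}$. (1) If $\rho_{j}$ is bounded from above on $S_{Y}\cap C$ for all $j\in J$, then there exist constants $K>0$, $\alpha_{j}\in\mathbb{R}$ $(j\in J)$, and a map $\gamma:S_{X}\to C$ such that: (a) $T\circ\gamma=\mathrm{id}_{S_{X}}$; (b) $\|\gamma(x)\|\leq K$ for all $x\in S_{X}$; (c) $\rho_{j}(\gamma(x))\leq\alpha_{j}$ for all $x\in S_{X}$ and $j\in J$. (2) If $K>0$, $\alpha_{j}\in\mathbb{R}$ $(j\in J)$, and $\gamma:S_{X}\to C$ satisfy (a), (b) and (c) in part (1), then, for every $\varepsilon>0$, there exists a continuous positively homogeneous map $\gamma_{\varepsilon}:X\to C$ such that: (a) $T\circ\gamma_{\varepsilon}=\mathrm{id}_{X}$; (b) $\|\gamma_{\varepsilon}(x)\|\leq(K+\varepsilon)\|x\|$ for all $x\in X$; (c) $\rho_{j}(\gamma_{\varepsilon}(x))\leq(\alpha_{j}+\varepsilon)\|x\|$ for all $x\in X$ and $j\in J$. (In part (2) the maps $\rho_j$ are not required to be bounded from above on $S_Y\cap C$.)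
   Context: A subset $C$ of a real or complex vector space is a cone if $C+C\subseteq C$ and $\lambda C\subseteq C$ for all real $\lambda\geq 0$; it is proper if $C\cap(-C)=\{0\}$ (not assumed here). A map $T$ on a cone is additive if $T(u+v)=Tu+Tv$; a map $T$ on a cone or vector space is positively homogeneous if $T(\lambda u)=\lambda T(u)$ for all $u$ in its domain and all real $\lambda\geq0$; $\rho:C\to\mathbb{R}$ is subadditive if $\rho(u+v)\leq\rho(u)+\rho(v)$ for all $u,v\in C$. *)

theory Defs
  imports "HOL-Analysis.Analysis"
begin

(* Only real scalars enter the statement, so "real or complex Banach space" is rendered by the
   type class banach: a complex Banach space is an instance through restriction of scalars, with
   the same norm, topology, cones and positively homogeneous maps. Two distinct type variables of
   this class therefore cover spaces over different fields.

   A map on a subset C is a total function of which only the values on C are constrained. *)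

(* The library predicate cone expresses only closure under scalars c \<ge> 0; cones here are also
   closed under addition, and need not be proper. *)
definition additive_cone :: "'a::real_vector set \<Rightarrow> bool"
  where "additive_cone C \<longleftrightarrow> (\<forall>u\<in>C. \<forall>v\<in>C. u + v \<in> C) \<and> cone C"

definition additive_on :: "'a::real_vector set \<Rightarrow> ('a \<Rightarrow> 'b::real_vector) \<Rightarrow> bool"
  where "additive_on C T \<longleftrightarrow> (\<forall>u\<in>C. \<forall>v\<in>C. T (u + v) = T u + T v)"

definition pos_homogeneous_on :: "'a::real_vector set \<Rightarrow> ('a \<Rightarrow> 'b::real_vector) \<Rightarrow> bool"
  where "pos_homogeneous_on C T \<longleftrightarrow> (\<forall>u\<in>C. \<forall>c\<ge>0. T (c *\<^sub>R u) = c *\<^sub>R T u)"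

definition subadditive_on :: "'a::real_vector set \<Rightarrow> ('a \<Rightarrow> real) \<Rightarrow> bool"
  where "subadditive_on C \<rho> \<longleftrightarrow> (\<forall>u\<in>C. \<forall>v\<in>C. \<rho> (u + v) \<le> \<rho> u + \<rho> v)"

end

theory Submission
  imports Defs
begin

text \<open>
  Both parts produce a right inverse of \<open>T\<close> from a map \<open>h\<close> into \<open>C\<close> that inverts \<open>T\<close> only up
  to a relative error \<open>\<delta> < 1\<close>, that is, \<open>norm (x - T (h x)) \<le> \<delta> * norm x\<close>. With
  \<open>R x = x - T (h x)\<close> the series \<open>x \<mapsto> (\<Sum>n. h ((R ^^ n) x))\<close> converges geometrically, stays in the
  closed cone, and is mapped to \<open>x\<close> by a telescoping sum. It inherits continuity and positive
  homogeneity from \<open>h\<close>, and since its first term \<open>h x\<close> dominates, all bounds on \<open>h\<close> survive up to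
  an error that vanishes with \<open>\<delta>\<close> (locale \<open>approximate_right_inverse\<close>).

  For part (1), \<open>h\<close> with \<open>\<delta> = 1/2\<close> comes from the Baire category theorem, as in the open mapping
  theorem. As \<open>C\<close> need not be symmetric, the ball found in the closure of the image of a bounded part
  of \<open>C\<close> is moved to the origin by adding an element of \<open>C\<close> that \<open>T\<close> maps to minus its centre
  (\<open>almost_open\<close>, \<open>bounded_right_inverse\<close>).

  For part (2), \<open>h\<close> is obtained from \<open>\<gamma>\<close> by averaging its values over \<open>\<delta>\<close>-balls of the unit sphere
  and extending radially. If \<open>dist x y < \<delta>\<close>, then \<open>\<gamma> y\<close> lies in \<open>C\<close>, obeys the bounds and is mapped
  by \<open>T\<close> to a point within \<open>\<delta>\<close> of \<open>x\<close>. These conditions define a closed convex set, because \<open>T\<close>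
  is affine on \<open>C\<close> and the \<open>\<rho> j\<close> are convex there, so they pass to averages. What is needed
  is thus a continuous averaging at one fixed scale on a possibly non-separable sphere
  (\<open>continuous_local_averaging\<close>). It follows from A. H. Stone's decomposition of a metric space
  into countably many families of uniformly separated sets, by means of a well-ordering of the
  centres; a weighted series of bump functions then does the work of a locally finite partition of
  unity.
\<close>

section \<open>Continuous selections at a uniform scale\<close>

text \<open>
  If the label \<open>a\<close> of points of \<open>E\<close> changes only over distances at least \<open>s\<close>, then \<open>E\<close> is a union
  of uniformly separated pieces, one for each label. A function of the distance to \<open>E\<close> supported
  within \<open>s / 4\<close> is then a sum of bumps with separated supports, and on its support each point
  inherits the label of the unique nearby piece. The last conclusion also covers points on the
  boundary of the support; this is what makes the weighted label continuous in the next lemma.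
\<close>
lemma separated_set_bump:
  fixes E :: "'a::metric_space set" and a :: "'a \<Rightarrow> 'b"
  assumes s: "s > 0"
    and sep: "\<And>p p'. p \<in> E \<Longrightarrow> p' \<in> E \<Longrightarrow> dist p p' < s \<Longrightarrow> a p = a p'"
  obtains \<beta> :: "'a \<Rightarrow> real" and q :: "'a \<Rightarrow> 'b" where
    "continuous_on UNIV \<beta>"
    "\<And>x. 0 \<le> \<beta> x" "\<And>x. \<beta> x \<le> s"
    "\<And>p. p \<in> E \<Longrightarrow> \<beta> p > 0"
    "\<And>x. \<beta> x > 0 \<Longrightarrow> \<exists>p\<in>E. dist x p < s \<and> q x = a p"
    "\<And>x. \<exists>c. \<forall>\<^sub>F y in nhds x. \<beta> y > 0 \<longrightarrow> q y = c"
proof (cases "E = {}")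
  case True
  show ?thesis
    by (rule that[of "\<lambda>_. 0" undefined]) (use s True in auto)
next
  case False
  define \<beta> where "\<beta> = (\<lambda>x. max 0 (s / 4 - infdist x E))"
  have near: "\<exists>p\<in>E. dist x p < s / 4" if "\<beta> x > 0" for x
  proof -
    have "infdist x E < s / 4"
      using that by (auto simp: \<beta>_def max_def split: if_splits)
    then have "(INF p\<in>E. dist x p) < s / 4"
      using False by (simp add: infdist_notempty)
    then show ?thesis
      using False by (subst (asm) cINF_less_iff) auto
  qed
  define q where "q = (\<lambda>x. a (SOME p. p \<in> E \<and> dist x p < s / 4))"
  have q: "\<exists>p\<in>E. dist x p < s / 4 \<and> q x = a p" if "\<beta> x > 0" for x
  proof -
    have "\<exists>p. p \<in> E \<and> dist x p < s / 4" using near[OF that] by blast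
    from someI_ex[OF this] show ?thesis unfolding q_def by blast
  qed
  show ?thesis
  proof (rule that[of \<beta> q])
    show "continuous_on UNIV \<beta>"
      unfolding \<beta>_def by (intro continuous_intros)
    show "0 \<le> \<beta> x" for x by (simp add: \<beta>_def)
    show "\<beta> x \<le> s" for x
      using infdist_nonneg[of x E] s by (simp add: \<beta>_def)
    show "\<beta> p > 0" if "p \<in> E" for p
      using that s by (simp add: \<beta>_def)
    show "\<exists>p\<in>E. dist x p < s \<and> q x = a p" if "\<beta> x > 0" for x
      using q[OF that] s by force
    show "\<exists>c. \<forall>\<^sub>F y in nhds x. \<beta> y > 0 \<longrightarrow> q y = c" for x
    proof -
      \<comment> \<open>Two points of the support in a ball of radius \<open>s / 4\<close> have points of \<open>E\<close> at distance less
        than \<open>4 * (s / 4)\<close> nearby.\<close>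
      have same: "q y = q y'"
        if y: "dist y x < s / 4" "\<beta> y > 0" "dist y' x < s / 4" "\<beta> y' > 0" for y y'
      proof -
        obtain p p' where p: "p \<in> E" "dist y p < s / 4" "q y = a p"
          "p' \<in> E" "dist y' p' < s / 4" "q y' = a p'"
          using q[OF y(2)] q[OF y(4)] by blast
        have "dist p p' \<le> dist y p + dist y x + dist y' x + dist y' p'"
          by (smt (verit) dist_commute dist_triangle)
        with p y have "dist p p' < s" by linarith
        with sep p show ?thesis by simp
      qed
      have ev: "\<forall>\<^sub>F y in nhds x. dist y x < s / 4"
        unfolding eventually_nhds_metric using s by (intro exI[of _ "s / 4"]) auto
      show ?thesis
      proof (cases "\<exists>y. dist y x < s / 4 \<and> \<beta> y > 0")
        case True
        then obtain z where "dist z x < s / 4" "\<beta> z > 0" by blast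
        then show ?thesis
          using same by (intro exI[of _ "q z"] eventually_mono[OF ev]) blast
      next
        case False
        then show ?thesis
          by (intro exI[of _ undefined] eventually_mono[OF ev]) blast
      qed
    qed
  qed
qed

lemma continuous_weighted_label:
  fixes f :: "'b \<Rightarrow> 'c::real_normed_vector" and \<beta> :: "'a::metric_space \<Rightarrow> real"
  assumes "continuous_on UNIV \<beta>" and nonneg: "\<And>x. 0 \<le> \<beta> x"
    and lc: "\<And>x. \<exists>c. \<forall>\<^sub>F y in nhds x. \<beta> y > 0 \<longrightarrow> q y = c"
  shows "continuous_on UNIV (\<lambda>x. \<beta> x *\<^sub>R f (q x))"
proof (rule continuous_at_imp_continuous_on, rule ballI)
  fix x :: 'a
  obtain c where c: "\<forall>\<^sub>F y in nhds x. \<beta> y > 0 \<longrightarrow> q y = c" using lc by blast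
  have "isCont (\<lambda>y. \<beta> y *\<^sub>R f c) x"
    using assms(1) by (intro continuous_intros) (auto simp: continuous_on_eq_continuous_at)
  moreover have ev: "\<forall>\<^sub>F y in nhds x. \<beta> y *\<^sub>R f (q y) = \<beta> y *\<^sub>R f c"
    by (rule eventually_mono[OF c]) (metis nonneg less_eq_real_def scaleR_zero_left)
  ultimately show "isCont (\<lambda>y. \<beta> y *\<^sub>R f (q y)) x"
    using isCont_cong[OF ev] by blast
qed

text \<open>
  Stone's construction for the cover of \<open>S\<close> by \<open>\<delta>\<close>-balls. Fix a well-ordering and let \<open>a x\<close> be
  the least centre in \<open>S\<close> within \<open>\<delta>\<close> of \<open>x\<close>. Let \<open>p\<close> and \<open>p'\<close> have the labels
  \<open>a p\<close> and \<open>a p'\<close>, the former smaller. Minimality keeps \<open>p'\<close> at distance at least \<open>\<delta>\<close> from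
  \<open>a p\<close>, so if \<open>p\<close> is within \<open>\<delta> - (1/2)^n\<close> of \<open>a p\<close>, then \<open>p\<close> and \<open>p'\<close> are at least \<open>(1/2)^n\<close>
  apart. The sets \<open>E n\<close> of points at such a depth in their ball are therefore separated as in
  \<open>separated_set_bump\<close>, and together they contain \<open>S\<close>.
\<close>
lemma sigma_discrete_ball_bumps:
  fixes S :: "'a::metric_space set"
  assumes "\<delta> > 0"
  obtains \<beta> :: "nat \<Rightarrow> 'a \<Rightarrow> real" and q :: "nat \<Rightarrow> 'a \<Rightarrow> 'a" where
    "\<And>n. continuous_on UNIV (\<beta> n)"
    "\<And>n x. 0 \<le> \<beta> n x" "\<And>n x. \<beta> n x \<le> (1/2)^n"
    "\<And>n x. \<exists>c. \<forall>\<^sub>F y in nhds x. \<beta> n y > 0 \<longrightarrow> q n y = c"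
    "\<And>n x. \<beta> n x > 0 \<Longrightarrow> q n x \<in> S \<and> dist x (q n x) < \<delta>"
    "\<And>x. x \<in> S \<Longrightarrow> \<exists>n. \<beta> n x > 0"
proof -
  obtain r :: "'a rel" where r: "Well_order r" "Field r = UNIV"
    using well_ordering[where 'a = 'a] by blast
  then have wf: "wf (r - Id)" and lin: "linear_order_on UNIV r"
    by (simp_all add: well_order_on_def)
  from lin have tot: "(x, y) \<in> r \<or> (y, x) \<in> r" for x y
    by (cases "x = y")
      (simp_all add: linear_order_on_def partial_order_on_def preorder_on_def total_on_def refl_on_def)
  define Q where "Q = (\<lambda>x. {c \<in> S. dist x c < \<delta>})"
  define W where "W = {x. Q x \<noteq> {}}"
  define a where "a = (\<lambda>x. SOME c. c \<in> Q x \<and> (\<forall>d. (d, c) \<in> r - Id \<longrightarrow> d \<notin> Q x))"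
  have a: "a x \<in> Q x" "\<And>d. (d, a x) \<in> r - Id \<Longrightarrow> d \<notin> Q x" if x: "x \<in> W" for x
  proof -
    obtain c where "c \<in> Q x" using x by (auto simp: W_def)
    then have "\<exists>c. c \<in> Q x \<and> (\<forall>d. (d, c) \<in> r - Id \<longrightarrow> d \<notin> Q x)"
      using wfE_min[OF wf] by metis
    then have "a x \<in> Q x \<and> (\<forall>d. (d, a x) \<in> r - Id \<longrightarrow> d \<notin> Q x)"
      unfolding a_def by (rule someI_ex)
    then show "a x \<in> Q x" "\<And>d. (d, a x) \<in> r - Id \<Longrightarrow> d \<notin> Q x"
      by blast+
  qed
  define E where "E = (\<lambda>n::nat. {p \<in> W. dist p (a p) \<le> \<delta> - (1/2)^n})"
  have far: "(1/2)^n \<le> dist p p'"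
    if "p \<in> E n" "p' \<in> E n" "(a p, a p') \<in> r" "a p \<noteq> a p'" for n p p'
  proof -
    have "a p \<notin> Q p'" "a p \<in> S" "dist p (a p) \<le> \<delta> - (1/2)^n"
      using a[of p'] a[of p] that by (auto simp: E_def Q_def)
    then have "\<delta> \<le> dist p' (a p)" "dist p (a p) \<le> \<delta> - (1/2)^n" by (auto simp: Q_def)
    with dist_triangle[of p' "a p" p] show ?thesis by (simp add: dist_commute)
  qed
  have sep: "a p = a p'" if "p \<in> E n" "p' \<in> E n" "dist p p' < (1/2)^n" for n p p'
    using far[of p n p'] far[of p' n p] tot[of "a p" "a p'"] that by (force simp: dist_commute)
  define bump where "bump = (\<lambda>n \<beta> q. continuous_on UNIV \<beta> \<and> (\<forall>x. 0 \<le> \<beta> x \<and> \<beta> x \<le> (1/2::real)^n) \<and>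
      (\<forall>p\<in>E n. \<beta> p > 0) \<and> (\<forall>x. \<beta> x > 0 \<longrightarrow> (\<exists>p\<in>E n. dist x p < (1/2)^n \<and> q x = a p)) \<and>
      (\<forall>x. \<exists>c. \<forall>\<^sub>F y in nhds x. \<beta> y > 0 \<longrightarrow> q y = c))"
  have "\<exists>\<beta> q. bump n \<beta> q" for n
  proof (rule separated_set_bump[of "(1/2)^n" "E n" a])
    show "a p = a p'" if "p \<in> E n" "p' \<in> E n" "dist p p' < (1/2)^n" for p p'
      using sep that .
    fix \<beta> :: "'a \<Rightarrow> real" and q :: "'a \<Rightarrow> 'a"
    assume "continuous_on UNIV \<beta>" "\<And>x. 0 \<le> \<beta> x" "\<And>x. \<beta> x \<le> (1/2)^n" "\<And>p. p \<in> E n \<Longrightarrow> \<beta> p > 0"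
      "\<And>x. \<beta> x > 0 \<Longrightarrow> \<exists>p\<in>E n. dist x p < (1/2)^n \<and> q x = a p"
      "\<And>x. \<exists>c. \<forall>\<^sub>F y in nhds x. \<beta> y > 0 \<longrightarrow> q y = c"
    then have "bump n \<beta> q" by (simp add: bump_def)
    then show ?thesis by blast
  qed simp
  then obtain \<beta> q where "\<And>n. bump n (\<beta> n) (q n)" by metis
  then have bq: "\<And>n. continuous_on UNIV (\<beta> n)"
    "\<And>n x. 0 \<le> \<beta> n x" "\<And>n x. \<beta> n x \<le> (1/2::real)^n"
    "\<And>n p. p \<in> E n \<Longrightarrow> \<beta> n p > 0"
    "\<And>n x. \<beta> n x > 0 \<Longrightarrow> \<exists>p\<in>E n. dist x p < (1/2)^n \<and> q n x = a p"
    "\<And>n x. \<exists>c. \<forall>\<^sub>F y in nhds x. \<beta> n y > 0 \<longrightarrow> q n y = c"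
    unfolding bump_def by blast+
  show thesis
  proof (rule that[of \<beta> q])
    show "q n x \<in> S \<and> dist x (q n x) < \<delta>" if pos: "\<beta> n x > 0" for n x
    proof -
      obtain p where p: "p \<in> E n" "dist x p < (1/2)^n" "q n x = a p"
        using bq(5)[OF pos] by blast
      then have "a p \<in> S" "dist p (a p) \<le> \<delta> - (1/2)^n"
        using a[of p] by (auto simp: E_def Q_def)
      with p dist_triangle[of x "a p" p] show ?thesis by simp
    qed
    show "\<exists>n. \<beta> n x > 0" if "x \<in> S" for x
    proof -
      have W: "x \<in> W" using that assms by (auto simp: W_def Q_def)
      then have "0 < \<delta> - dist x (a x)" using a(1)[OF W] by (simp add: Q_def)
      then obtain n where "(1/2)^n < \<delta> - dist x (a x)"
        using real_arch_pow_inv[of "\<delta> - dist x (a x)" "1/2"] by force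
      with W have "x \<in> E n" by (simp add: E_def)
      then show ?thesis using bq(4) by blast
    qed
  qed (use bq in auto)
qed

text \<open>
  An infinite convex combination is the limit of its renormalised partial sums, which are ordinary
  convex combinations as soon as one weight is positive. Membership in \<open>A\<close> is asked only of the \<open>v n\<close>
  of positive weight, because the labels above are meaningful only there.
\<close>
lemma suminf_convex_combination_mem_closure:
  fixes v :: "nat \<Rightarrow> 'b::real_normed_vector" and b :: "nat \<Rightarrow> real"
  assumes b: "summable b" "\<And>n. 0 \<le> b n" "b m > 0"
    and v: "summable (\<lambda>n. b n *\<^sub>R v n)" "\<And>n. b n > 0 \<Longrightarrow> v n \<in> A"
  shows "(\<Sum>n. b n *\<^sub>R v n) /\<^sub>R (\<Sum>n. b n) \<in> closure (convex hull A)"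
proof -
  have pos: "suminf b > 0" using suminf_pos2[OF b(1,2,3)] .
  let ?P = "\<lambda>N. \<Sum>n<N. b n"
  let ?V = "\<lambda>N. \<Sum>n<N. b n *\<^sub>R v n"
  have lim: "(\<lambda>N. ?V N /\<^sub>R ?P N) \<longlonglongrightarrow> (\<Sum>n. b n *\<^sub>R v n) /\<^sub>R (\<Sum>n. b n)"
    using pos by (intro tendsto_intros summable_LIMSEQ b v) auto
  have "?V N /\<^sub>R ?P N \<in> convex hull A" if "N > m" for N
  proof -
    have "b m \<le> ?P N" using that b by (intro member_le_sum) auto
    then have P: "?P N > 0" using b(3) by linarith
    let ?I = "{n. n < N \<and> b n > 0}"
    have zero: "b n = 0" if "n \<in> {..<N} - ?I" for n using that b(2)[of n] by auto
    have "?P N = sum b ?I" by (rule sum.mono_neutral_right) (use zero in auto)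
    moreover have "?V N = (\<Sum>n\<in>?I. b n *\<^sub>R v n)"
      by (rule sum.mono_neutral_right) (use zero in auto)
    ultimately have P_eq: "?P N = sum b ?I" and V_eq: "?V N = (\<Sum>n\<in>?I. b n *\<^sub>R v n)" .
    have eq: "?V N /\<^sub>R ?P N = (\<Sum>n\<in>?I. (b n / ?P N) *\<^sub>R v n)"
      unfolding V_eq by (simp add: scaleR_sum_right divide_inverse_commute)
    have one: "(\<Sum>n\<in>?I. b n / ?P N) = 1"
      unfolding sum_divide_distrib[symmetric] P_eq[symmetric] using P by simp
    show ?thesis unfolding eq
      by (rule convex_sum) (use one P v(2) in \<open>auto intro: hull_inc\<close>)
  qed
  then have "\<forall>\<^sub>F N in sequentially. ?V N /\<^sub>R ?P N \<in> closure (convex hull A)"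
    unfolding eventually_sequentially
    by (intro exI[of _ "Suc m"] allI impI subsetD[OF closure_subset]) simp
  then show ?thesis
    using lim by (intro Lim_in_closed_set[OF closed_closure]) auto
qed

text \<open>
  The bumps of \<open>sigma_discrete_ball_bumps\<close> are bounded by \<open>(1/2)^n\<close>, so the sum of weights and the
  weighted sum of values of \<open>f\<close> both converge uniformly, and their quotient is continuous although
  \<open>f\<close> is arbitrary. Boundedness of \<open>f\<close> serves the convergence of the second series.
\<close>
proposition continuous_local_averaging:
  fixes f :: "'a::metric_space \<Rightarrow> 'b::banach"
  assumes bdd: "\<And>x. x \<in> S \<Longrightarrow> norm (f x) \<le> K" and \<delta>: "\<delta> > 0"
  obtains g where "continuous_on S g"
    "\<And>x. x \<in> S \<Longrightarrow> g x \<in> closure (convex hull (f ` (S \<inter> ball x \<delta>)))"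
proof (rule sigma_discrete_ball_bumps[OF \<delta>, of S])
  fix \<beta> :: "nat \<Rightarrow> 'a \<Rightarrow> real" and q :: "nat \<Rightarrow> 'a \<Rightarrow> 'a"
  assume bq:
    "\<And>n. continuous_on UNIV (\<beta> n)"
    "\<And>n x. 0 \<le> \<beta> n x" "\<And>n x. \<beta> n x \<le> (1/2)^n"
    "\<And>n x. \<exists>c. \<forall>\<^sub>F y in nhds x. \<beta> n y > 0 \<longrightarrow> q n y = c"
    "\<And>n x. \<beta> n x > 0 \<Longrightarrow> q n x \<in> S \<and> dist x (q n x) < \<delta>"
    "\<And>x. x \<in> S \<Longrightarrow> \<exists>n. \<beta> n x > 0"
  have le1: "norm (\<beta> n x) \<le> (1/2)^n" for n x using bq(2,3) by simp
  have le2: "norm (\<beta> n x *\<^sub>R f (q n x)) \<le> (1/2)^n * \<bar>K\<bar>" for n x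
  proof (cases "\<beta> n x > 0")
    case True
    then have "norm (f (q n x)) \<le> \<bar>K\<bar>" using bq(5) bdd by (meson abs_ge_self order_trans)
    then show ?thesis using bq(2,3) by (auto intro!: mult_mono)
  next
    case False
    then have "\<beta> n x = 0" using bq(2)[of n x] by linarith
    then show ?thesis by simp
  qed
  have s1: "summable (\<lambda>n. (1/2::real)^n)" by (simp add: summable_geometric)
  have s2: "summable (\<lambda>n. (1/2::real)^n * \<bar>K\<bar>)" using s1 by (rule summable_mult2)
  have c1: "continuous_on UNIV (\<lambda>x. \<Sum>n. \<beta> n x)"
    by (rule uniform_limit_theorem[OF _ Weierstrass_m_test[OF le1 s1]])
      (auto intro!: always_eventually continuous_on_sum bq)
  have c2: "continuous_on UNIV (\<lambda>x. \<Sum>n. \<beta> n x *\<^sub>R f (q n x))"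
    by (rule uniform_limit_theorem[OF _ Weierstrass_m_test[OF le2 s2]])
      (auto intro!: always_eventually continuous_on_sum
        continuous_weighted_label[where f = f, OF bq(1,2,4)])
  have sb: "summable (\<lambda>n. \<beta> n x)" for x
    using le1 s1 by (rule summable_comparison_test'[rotated])
  have sf: "summable (\<lambda>n. \<beta> n x *\<^sub>R f (q n x))" for x
    using le2 s2 by (rule summable_comparison_test'[rotated])
  show thesis
  proof (rule that[of "\<lambda>x. (\<Sum>n. \<beta> n x *\<^sub>R f (q n x)) /\<^sub>R (\<Sum>n. \<beta> n x)"])
    have "(\<Sum>n. \<beta> n x) \<noteq> 0" if "x \<in> S" for x
      using bq(6)[OF that] suminf_pos2[OF sb bq(2)] by (metis less_irrefl)
    then show "continuous_on S (\<lambda>x. (\<Sum>n. \<beta> n x *\<^sub>R f (q n x)) /\<^sub>R (\<Sum>n. \<beta> n x))"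
      by (intro continuous_intros continuous_on_subset[OF c1] continuous_on_subset[OF c2]) auto
    show "(\<Sum>n. \<beta> n x *\<^sub>R f (q n x)) /\<^sub>R (\<Sum>n. \<beta> n x) \<in> closure (convex hull (f ` (S \<inter> ball x \<delta>)))"
      if x: "x \<in> S" for x
    proof -
      obtain m where "\<beta> m x > 0" using bq(6)[OF x] by blast
      then show ?thesis
        by (rule suminf_convex_combination_mem_closure[OF sb bq(2) _ sf])
          (use bq(5) in auto)
    qed
  qed
qed

section \<open>Radial extension from the unit sphere\<close>

lemma continuous_on_radial_extension:
  fixes g :: "'a::real_normed_vector \<Rightarrow> 'b::real_normed_vector"
  assumes g: "continuous_on (sphere 0 1) g" and bdd: "\<And>x. norm x = 1 \<Longrightarrow> norm (g x) \<le> K"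
  shows "continuous_on UNIV (\<lambda>x. norm x *\<^sub>R g (sgn x))"
proof (intro continuous_at_imp_continuous_on ballI)
  fix x :: 'a
  show "isCont (\<lambda>x. norm x *\<^sub>R g (sgn x)) x"
  proof (cases "x = 0")
    case True
    have le: "norm (norm y *\<^sub>R g (sgn y)) \<le> norm y * K" for y :: 'a
      by (cases "y = 0") (auto intro!: mult_left_mono bdd simp: norm_sgn)
    have "((\<lambda>y::'a. norm y * K) \<longlongrightarrow> norm (0::'a) * K) (at 0)"
      by (intro tendsto_intros)
    then have "((\<lambda>y::'a. norm y * K) \<longlongrightarrow> 0) (at 0)" by simp
    then have "((\<lambda>y. norm y *\<^sub>R g (sgn y)) \<longlongrightarrow> 0) (at 0)"
      by (rule Lim_null_comparison[rotated]) (use le in auto)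
    with True show ?thesis by (simp add: isCont_def)
  next
    case False
    have "continuous_on (- {0}) (\<lambda>y. norm y *\<^sub>R g (sgn y))"
      unfolding sgn_div_norm
      by (intro continuous_intros continuous_on_compose2[OF g]) (auto, metis left_inverse norm_eq_zero)
    with False show ?thesis
      by (simp add: continuous_on_eq_continuous_at open_Compl)
  qed
qed

lemma pos_homogeneous_radial_extension:
  "pos_homogeneous_on UNIV (\<lambda>x. norm x *\<^sub>R g (sgn x))"
  by (auto simp: pos_homogeneous_on_def sgn_scaleR sgn_if)

section \<open>From approximate to exact right inverses\<close>

locale closed_cone_map =
  fixes C :: "'y::banach set" and T :: "'y \<Rightarrow> 'x::banach"
  assumes closed: "closed C" and cone: "additive_cone C" and nonempty: "C \<noteq> {}"
    and cont: "continuous_on C T"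
    and additive: "additive_on C T" and homogeneous: "pos_homogeneous_on C T"
begin

lemma add_mem: "u \<in> C \<Longrightarrow> v \<in> C \<Longrightarrow> u + v \<in> C"
  using cone by (simp add: additive_cone_def)

lemma scale_mem: "u \<in> C \<Longrightarrow> c \<ge> 0 \<Longrightarrow> c *\<^sub>R u \<in> C"
  using cone by (simp add: additive_cone_def mem_cone)

lemma zero_mem: "0 \<in> C"
  using nonempty scale_mem[of _ 0] by auto

lemma map_add: "u \<in> C \<Longrightarrow> v \<in> C \<Longrightarrow> T (u + v) = T u + T v"
  using additive by (simp add: additive_on_def)

lemma map_scale: "u \<in> C \<Longrightarrow> c \<ge> 0 \<Longrightarrow> T (c *\<^sub>R u) = c *\<^sub>R T u"
  using homogeneous by (simp add: pos_homogeneous_on_def)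

lemma map_zero: "T 0 = 0"
  using map_scale[OF zero_mem, of 0] by simp

lemma sum_mem: "(\<And>i. f i \<in> C) \<Longrightarrow> (\<Sum>i<n. f i) \<in> C" for f :: "nat \<Rightarrow> 'y"
  by (induction n) (auto simp: zero_mem add_mem)

lemma map_sum: "(\<And>i. f i \<in> C) \<Longrightarrow> T (\<Sum>i<n. f i) = (\<Sum>i<n. T (f i))" for f :: "nat \<Rightarrow> 'y"
  by (induction n) (auto simp: map_zero map_add sum_mem)

lemma convex: "convex C"
  by (auto simp: convex_def intro!: add_mem scale_mem)

end

text \<open>
  A right inverse up to a relative error below one is corrected by applying it repeatedly to what is
  left over.
\<close>
locale approximate_right_inverse = closed_cone_map C T
  for C :: "'y::banach set" and T :: "'y \<Rightarrow> 'x::banach" +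
  fixes h :: "'x \<Rightarrow> 'y" and K \<delta> :: real
  assumes h_mem: "h x \<in> C"
    and h_bound: "norm (h x) \<le> K * norm x"
    and h_error: "norm (x - T (h x)) \<le> \<delta> * norm x"
    and K_nonneg: "0 \<le> K" and \<delta>_nonneg: "0 \<le> \<delta>" and \<delta>_less: "\<delta> < 1"
begin

definition residual :: "'x \<Rightarrow> 'x"
  where "residual x = x - T (h x)"

definition exact_inverse :: "'x \<Rightarrow> 'y"
  where "exact_inverse x = (\<Sum>n. h ((residual ^^ n) x))"

lemma residual_pow_bound: "norm ((residual ^^ n) x) \<le> \<delta> ^ n * norm x"
proof (induction n)
  case (Suc n)
  have "norm ((residual ^^ Suc n) x) \<le> \<delta> * norm ((residual ^^ n) x)"
    using h_error by (simp add: residual_def)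
  also have "\<dots> \<le> \<delta> * (\<delta> ^ n * norm x)"
    using Suc \<delta>_nonneg by (rule mult_left_mono)
  finally show ?case by (simp add: mult.assoc)
qed simp

lemma term_bound: "norm (h ((residual ^^ n) x)) \<le> K * (\<delta> ^ n * norm x)"
  using h_bound[of "(residual ^^ n) x"] mult_left_mono[OF residual_pow_bound K_nonneg]
  by (rule order_trans)

lemma bound_sums: "(\<lambda>n. K * (\<delta> ^ n * c)) sums (K / (1 - \<delta>) * c)"
  using sums_mult[OF sums_mult2[OF geometric_sums[of \<delta>]], of K c] \<delta>_nonneg \<delta>_less by simp

lemma summable_terms: "summable (\<lambda>n. norm (h ((residual ^^ n) x)))"
  by (rule summable_comparison_test'[OF sums_summable[OF bound_sums]]) (use term_bound in auto)

lemma partial_sums_tendsto: "(\<lambda>n. \<Sum>i<n. h ((residual ^^ i) x)) \<longlonglongrightarrow> exact_inverse x"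
  unfolding exact_inverse_def
  by (rule summable_LIMSEQ[OF summable_norm_cancel[OF summable_terms]])

lemma exact_inverse_mem: "exact_inverse x \<in> C"
  by (rule closed_sequentially[OF closed _ partial_sums_tendsto]) (simp add: sum_mem h_mem)

lemma exact_inverse_bound: "norm (exact_inverse x) \<le> K / (1 - \<delta>) * norm x"
proof -
  have "norm (exact_inverse x) \<le> (\<Sum>n. norm (h ((residual ^^ n) x)))"
    unfolding exact_inverse_def by (rule summable_norm[OF summable_terms])
  also have "\<dots> \<le> (\<Sum>n. K * (\<delta> ^ n * norm x))"
    by (rule suminf_le[OF term_bound summable_terms sums_summable[OF bound_sums]])
  finally show ?thesis using sums_unique[OF bound_sums] by simp
qed

lemma map_exact_inverse: "T (exact_inverse x) = x"
proof -
  have "T (\<Sum>i<n. h ((residual ^^ i) x)) = x - (residual ^^ n) x" for n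
    unfolding map_sum[OF h_mem] by (induction n) (auto simp: residual_def)
  moreover have "(\<lambda>n. (residual ^^ n) x) \<longlonglongrightarrow> 0"
  proof (rule Lim_null_comparison)
    show "\<forall>\<^sub>F n in sequentially. norm ((residual ^^ n) x) \<le> \<delta> ^ n * norm x"
      using residual_pow_bound by simp
    show "(\<lambda>n. \<delta> ^ n * norm x) \<longlonglongrightarrow> 0"
      using \<delta>_nonneg \<delta>_less by (intro tendsto_mult_left_zero LIMSEQ_realpow_zero)
  qed
  ultimately have "(\<lambda>n. T (\<Sum>i<n. h ((residual ^^ i) x))) \<longlonglongrightarrow> x - 0"
    by (simp only: tendsto_diff[OF tendsto_const])
  moreover have "(\<lambda>n. T (\<Sum>i<n. h ((residual ^^ i) x))) \<longlonglongrightarrow> T (exact_inverse x)"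
    by (rule continuous_on_tendsto_compose[OF cont partial_sums_tendsto exact_inverse_mem])
      (simp add: sum_mem h_mem)
  ultimately show ?thesis using LIMSEQ_unique by fastforce
qed

text \<open>
  The bound \<open>a\<close> may be negative, and then the terms of the series can be estimated only by its
  absolute value. The first term, the only one not small with \<open>\<delta>\<close>, is therefore kept apart:
  it contributes \<open>a * norm x\<close>, the others at most \<open>\<bar>a\<bar> * (\<delta> / (1 - \<delta>)) * norm x\<close>.
\<close>
lemma exact_inverse_subadditive_bound:
  assumes "continuous_on C \<rho>" and sub: "subadditive_on C \<rho>" and hom: "pos_homogeneous_on C \<rho>"
    and \<rho>: "\<And>x. \<rho> (h x) \<le> a * norm x"
  shows "\<rho> (exact_inverse x) \<le> (a + \<bar>a\<bar> * (\<delta> / (1 - \<delta>))) * norm x"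
proof -
  have zero: "\<rho> 0 = 0"
    using hom zero_mem unfolding pos_homogeneous_on_def by (metis order_refl scaleR_zero_left)
  have sum: "\<rho> (\<Sum>i<n. f i) \<le> (\<Sum>i<n. \<rho> (f i))" if "\<And>i. f i \<in> C" for f :: "nat \<Rightarrow> 'y" and n
  proof (induction n)
    case (Suc n)
    have "\<rho> ((\<Sum>i<n. f i) + f n) \<le> \<rho> (\<Sum>i<n. f i) + \<rho> (f n)"
      using sub sum_mem that by (simp add: subadditive_on_def)
    with Suc show ?case by simp
  qed (simp add: zero)
  have partial: "\<rho> (\<Sum>i<Suc m. h ((residual ^^ i) x)) \<le> (a + \<bar>a\<bar> * (\<delta> / (1 - \<delta>))) * norm x" for m
  proof -
    have "\<rho> (\<Sum>i<Suc m. h ((residual ^^ i) x)) \<le> (\<Sum>i<Suc m. a * norm ((residual ^^ i) x))"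
      by (rule order_trans[OF sum[OF h_mem] sum_mono[OF \<rho>]])
    also have "\<dots> = a * norm x + (\<Sum>i<m. a * norm ((residual ^^ Suc i) x))"
      by (subst sum.lessThan_Suc_shift) simp
    also have "\<dots> \<le> a * norm x + (\<Sum>i<m. \<bar>a\<bar> * (\<delta> ^ Suc i * norm x))"
      by (intro add_left_mono sum_mono mult_mono residual_pow_bound) auto
    also have "(\<Sum>i<m. \<bar>a\<bar> * (\<delta> ^ Suc i * norm x)) = \<bar>a\<bar> * norm x * \<delta> * (\<Sum>i<m. \<delta> ^ i)"
      by (simp add: sum_distrib_left mult_ac)
    also have "\<dots> \<le> \<bar>a\<bar> * norm x * \<delta> * (1 / (1 - \<delta>))"
    proof (rule mult_left_mono)
      have "(\<Sum>i<m. \<delta> ^ i) \<le> (\<Sum>i. \<delta> ^ i)"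
        by (rule sum_le_suminf) (use \<delta>_nonneg \<delta>_less in \<open>auto simp: summable_geometric\<close>)
      then show "(\<Sum>i<m. \<delta> ^ i) \<le> 1 / (1 - \<delta>)"
        using \<delta>_nonneg \<delta>_less by (simp add: suminf_geometric)
    qed (use \<delta>_nonneg in auto)
    finally show ?thesis by (simp add: algebra_simps)
  qed
  have "(\<lambda>n. \<rho> (\<Sum>i<n. h ((residual ^^ i) x))) \<longlonglongrightarrow> \<rho> (exact_inverse x)"
    by (rule continuous_on_tendsto_compose[OF assms(1) partial_sums_tendsto exact_inverse_mem])
      (simp add: sum_mem h_mem)
  from LIMSEQ_Suc[OF this] partial show ?thesis
    by (intro LIMSEQ_le_const2) blast+
qed

lemma exact_inverse_homogeneous:
  assumes "pos_homogeneous_on UNIV h"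
  shows "pos_homogeneous_on UNIV exact_inverse"
  unfolding pos_homogeneous_on_def
proof (intro ballI allI impI)
  fix x :: 'x and c :: real assume c: "0 \<le> c"
  have h: "h (c *\<^sub>R y) = c *\<^sub>R h y" for y
    using assms c by (simp add: pos_homogeneous_on_def)
  have "(residual ^^ n) (c *\<^sub>R x) = c *\<^sub>R (residual ^^ n) x" for n
    by (induction n) (simp_all add: residual_def h map_scale h_mem c scaleR_diff_right)
  then show "exact_inverse (c *\<^sub>R x) = c *\<^sub>R exact_inverse x"
    unfolding exact_inverse_def
    by (simp add: h suminf_scaleR_right[OF summable_norm_cancel[OF summable_terms]])
qed

text \<open>
  The terms of the series are bounded by \<open>K * \<delta> ^ n * norm x\<close>, hence it converges uniformly on
  every ball.
\<close>
lemma continuous_exact_inverse: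
  assumes h: "continuous_on UNIV h"
  shows "continuous_on UNIV exact_inverse"
proof -
  have res: "continuous_on UNIV residual"
    unfolding residual_def[abs_def]
    by (intro continuous_intros continuous_on_compose2[OF cont h]) (use h_mem in auto)
  have pow: "continuous_on UNIV (residual ^^ n)" for n
    by (induction n) (auto intro: continuous_on_compose2[OF res] simp: o_def)
  have "continuous_on (ball 0 r) exact_inverse" for r
  proof -
    have le: "norm (h ((residual ^^ n) x)) \<le> K * (\<delta> ^ n * r)" if "x \<in> ball 0 r" for n x
    proof (rule order_trans[OF term_bound])
      show "K * (\<delta> ^ n * norm x) \<le> K * (\<delta> ^ n * r)"
        using that K_nonneg \<delta>_nonneg by (intro mult_left_mono) auto
    qed
    have "continuous_on (ball 0 r) (\<lambda>x. h ((residual ^^ n) x))" for n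
      by (intro continuous_on_compose2[OF h] continuous_on_subset[OF pow]) auto
    then show ?thesis
      unfolding exact_inverse_def[abs_def]
      by (intro uniform_limit_theorem[OF _ Weierstrass_m_test[OF le sums_summable[OF bound_sums]]])
        (auto intro!: always_eventually continuous_on_sum)
  qed
  then have "isCont exact_inverse x" for x
    by (rule continuous_on_interior[of "ball 0 (norm x + 1)"]) auto
  then show ?thesis
    by (simp add: continuous_at_imp_continuous_on)
qed

end

section \<open>The open mapping theorem for closed cones\<close>

context closed_cone_map
begin

text \<open>
  By surjectivity the closures of the images of \<open>C \<inter> cball 0 n\<close> cover the Banach space, so one of
  them contains a ball. Its centre \<open>x0\<close> cannot be removed by symmetry, as \<open>C\<close> contains no
  negatives in general; instead \<open>- x0 = T c0\<close> for some \<open>c0\<close> in \<open>C\<close>, and adding \<open>c0\<close> translates the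
  ball to the origin while enlarging the norms by at most \<open>norm c0\<close>.
\<close>
lemma almost_open:
  assumes surj: "T ` C = UNIV"
  obtains r R where "r > 0" "R > 0" "ball 0 r \<subseteq> closure (T ` (C \<inter> cball 0 R))"
proof -
  let ?F = "\<lambda>n::nat. closure (T ` (C \<inter> cball 0 (real n)))"
  have "\<exists>n. interior (?F n) \<noteq> {}"
  proof (rule ccontr)
    assume "\<not> ?thesis"
    then have "(euclidean :: 'x topology) interior_of \<Union> (range ?F) = {}"
      by (intro Baire_category_alt) (auto simp: completely_metrizable_space_euclidean)
    moreover have "\<Union> (range ?F) = UNIV"
    proof -
      have "\<exists>n. x \<in> ?F n" for x
      proof -
        obtain u where "u \<in> C" "T u = x" using surj by (metis UNIV_I imageE)
        moreover obtain n :: nat where "norm u \<le> n" using real_arch_simple by blast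
        ultimately have "x \<in> T ` (C \<inter> cball 0 (real n))" by auto
        then have "x \<in> ?F n" by (rule subsetD[OF closure_subset])
        then show ?thesis ..
      qed
      then show ?thesis by blast
    qed
    ultimately show False by simp
  qed
  then obtain n x0 r where r: "r > 0" "ball x0 r \<subseteq> ?F n"
    by (metis ex_in_conv mem_interior)
  obtain c0 where c0: "c0 \<in> C" "T c0 = - x0" using surj by (metis UNIV_I imageE)
  have "ball 0 r \<subseteq> closure (T ` (C \<inter> cball 0 (real n + norm c0 + 1)))"
  proof
    fix x :: 'x assume "x \<in> ball 0 r"
    then have "x0 + x \<in> ?F n" using r(2) by (auto simp: dist_norm)
    then have "(\<lambda>y. - x0 + y) (x0 + x) \<in> closure ((\<lambda>y. - x0 + y) ` T ` (C \<inter> cball 0 (real n)))"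
      unfolding closure_translation by (rule imageI)
    moreover have sub: "(\<lambda>y. - x0 + y) ` T ` (C \<inter> cball 0 (real n)) \<subseteq> T ` (C \<inter> cball 0 (real n + norm c0 + 1))"
    proof clarsimp
      fix u assume u: "u \<in> C" "norm u \<le> real n"
      then have "T u - x0 = T (c0 + u)" using map_add[OF c0(1) u(1)] c0(2) by simp
      moreover have "norm (c0 + u) \<le> real n + norm c0 + 1"
        using norm_triangle_ineq[of c0 u] u by simp
      ultimately show "T u - x0 \<in> T ` (C \<inter> cball 0 (real n + norm c0 + 1))"
        using add_mem[OF c0(1) u(1)] by auto
    qed
    ultimately show "x \<in> closure (T ` (C \<inter> cball 0 (real n + norm c0 + 1)))"
      using subsetD[OF closure_mono[OF sub]] by simp
  qed
  with r(1) show thesis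
    by (intro that[of r "real n + norm c0 + 1"]) (auto intro: add_nonneg_pos)
qed

text \<open>
  A vector \<open>x\<close> is scaled to norm \<open>r / 2\<close>, approximated there to within a quarter of \<open>r\<close>, which is
  half its norm, and scaled back.
\<close>
lemma halving_right_inverse:
  assumes surj: "T ` C = UNIV"
  obtains M h where "M > 0" "\<And>x. h x \<in> C" "\<And>x. norm (h x) \<le> M * norm x"
    "\<And>x. norm (x - T (h x)) \<le> 1 / 2 * norm x"
proof -
  obtain r R where r: "r > 0" "R > 0" "ball 0 r \<subseteq> closure (T ` (C \<inter> cball 0 R))"
    using almost_open[OF surj] .
  have "\<exists>u\<in>C. norm u \<le> 2 * R / r * norm x \<and> norm (x - T u) \<le> 1 / 2 * norm x" for x
  proof (cases "x = 0")
    case True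
    then show ?thesis using zero_mem map_zero by (intro bexI[of _ 0]) auto
  next
    case False
    define t where "t = r / (2 * norm x)"
    have t: "t > 0" using False r by (simp add: t_def)
    have "t *\<^sub>R x \<in> ball 0 r" using False r by (simp add: t_def)
    then have "t *\<^sub>R x \<in> closure (T ` (C \<inter> cball 0 R))" using r(3) by blast
    moreover have "0 < t * (1 / 2 * norm x)" using t False by simp
    ultimately obtain y where "y \<in> T ` (C \<inter> cball 0 R)" "dist y (t *\<^sub>R x) < t * (1 / 2 * norm x)"
      unfolding closure_approachable by blast
    then obtain u where u: "u \<in> C" "norm u \<le> R" "dist (T u) (t *\<^sub>R x) < t * (1 / 2 * norm x)"
      by auto
    let ?v = "(1 / t) *\<^sub>R u"
    have "norm ?v \<le> R / t" using u t by (simp add: divide_right_mono)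
    also have "\<dots> = 2 * R / r * norm x" by (simp add: t_def)
    finally have 1: "norm ?v \<le> 2 * R / r * norm x" .
    have "x - T ?v = (1 / t) *\<^sub>R (t *\<^sub>R x - T u)"
      using u t by (simp add: map_scale scaleR_diff_right)
    then have "norm (x - T ?v) = dist (T u) (t *\<^sub>R x) / t"
      using t by (simp add: dist_norm norm_minus_commute)
    also have "\<dots> \<le> 1 / 2 * norm x" using u t by (simp add: field_simps)
    finally show ?thesis using 1 scale_mem[OF u(1), of "1 / t"] t by (intro bexI[of _ ?v]) auto
  qed
  then obtain h where "\<And>x. h x \<in> C \<and> norm (h x) \<le> 2 * R / r * norm x \<and> norm (x - T (h x)) \<le> 1 / 2 * norm x"
    by metis
  then show thesis
    using r by (intro that[of "2 * R / r" h]) auto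
qed

proposition bounded_right_inverse:
  assumes surj: "T ` C = UNIV"
  obtains K \<gamma> where "K > 0" "\<And>x. \<gamma> x \<in> C" "\<And>x. T (\<gamma> x) = x" "\<And>x. norm (\<gamma> x) \<le> K * norm x"
proof -
  obtain M h where h: "M > 0" "\<And>x. h x \<in> C" "\<And>x. norm (h x) \<le> M * norm x"
    "\<And>x. norm (x - T (h x)) \<le> 1 / 2 * norm x"
    using halving_right_inverse[OF surj] by metis
  interpret approximate_right_inverse C T h M "1 / 2"
    by unfold_locales (use h in auto)
  show thesis
    using exact_inverse_mem map_exact_inverse exact_inverse_bound h(1)
    by (intro that[of "M / (1 - 1 / 2)" exact_inverse]) auto
qed

text \<open>
  The upper bound on the sphere is replaced by a nonnegative one, so that the resulting linear
  estimate can be combined with an upper bound on \<open>norm u\<close>.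
\<close>
lemma bounded_above_on_cone:
  assumes hom: "pos_homogeneous_on C \<rho>" and bdd: "bdd_above (\<rho> ` (sphere 0 1 \<inter> C))"
  obtains b :: real where "b \<ge> 0" "\<And>u. u \<in> C \<Longrightarrow> \<rho> u \<le> b * norm u"
proof -
  obtain b where b: "\<And>u. norm u = 1 \<Longrightarrow> u \<in> C \<Longrightarrow> \<rho> u \<le> b"
    using bdd unfolding bdd_above_def by fastforce
  have "\<rho> u \<le> max 0 b * norm u" if u: "u \<in> C" for u
  proof (cases "u = 0")
    case True
    have "\<rho> (0 *\<^sub>R u) = 0 *\<^sub>R \<rho> u" using hom u unfolding pos_homogeneous_on_def by blast
    with True show ?thesis by simp
  next
    case False
    have sgn_mem: "sgn u \<in> C"
      unfolding sgn_div_norm by (rule scale_mem[OF u]) simp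
    have "\<rho> u = \<rho> (norm u *\<^sub>R sgn u)" using False by (simp add: sgn_div_norm)
    also have "\<dots> = norm u * \<rho> (sgn u)"
      using hom sgn_mem unfolding pos_homogeneous_on_def by (metis norm_ge_zero real_scaleR_def)
    also have "\<dots> \<le> norm u * max 0 b"
    proof (rule mult_left_mono)
      have "\<rho> (sgn u) \<le> b"
        using b[of "sgn u"] False sgn_mem by (simp add: norm_sgn)
      then show "\<rho> (sgn u) \<le> max 0 b" by simp
    qed simp
    finally show ?thesis by (simp add: mult.commute)
  qed
  then show thesis by (intro that[of "max 0 b"]) auto
qed

end

section \<open>Continuous right inverses\<close>

context closed_cone_map
begin

lemma convex_sublevel:
  fixes \<rho> :: "'y \<Rightarrow> real"
  assumes "subadditive_on C \<rho>" "pos_homogeneous_on C \<rho>"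
  shows "convex {u \<in> C. \<rho> u \<le> a}"
proof (rule convexI)
  fix u v :: 'y and s t :: real
  assume uv: "u \<in> {u \<in> C. \<rho> u \<le> a}" "v \<in> {u \<in> C. \<rho> u \<le> a}" and st: "0 \<le> s" "0 \<le> t" "s + t = 1"
  then have C: "s *\<^sub>R u \<in> C" "t *\<^sub>R v \<in> C" by (auto intro: scale_mem)
  have "\<rho> (s *\<^sub>R u + t *\<^sub>R v) \<le> \<rho> (s *\<^sub>R u) + \<rho> (t *\<^sub>R v)"
    using assms(1) C by (simp add: subadditive_on_def)
  also have "\<dots> = s * \<rho> u + t * \<rho> v"
    using assms(2) uv st by (simp add: pos_homogeneous_on_def)
  also have "\<dots> \<le> s * a + t * a" using uv st by (intro add_mono mult_left_mono) auto
  also have "\<dots> = a" using st by (simp flip: distrib_right)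
  finally show "s *\<^sub>R u + t *\<^sub>R v \<in> {u \<in> C. \<rho> u \<le> a}" using add_mem[OF C] by simp
qed

lemma convex_vimage:
  assumes "convex B"
  shows "convex {u \<in> C. T u \<in> B}"
  using assms by (auto simp: convex_def add_mem scale_mem map_add map_scale)

text \<open>
  Each required property of \<open>g x\<close> says that it belongs to a closed convex subset \<open>D\<close> of the space.
  Since \<open>\<gamma> y\<close> belongs to \<open>D\<close> for all \<open>y\<close> of the sphere within \<open>\<delta>\<close> of \<open>x\<close>, so does the local
  average \<open>g x\<close>. The bounds on \<open>g\<close> are exactly those on \<open>\<gamma>\<close>; only the equation \<open>T (\<gamma> x) = x\<close>
  is weakened.
\<close>
lemma continuous_approximate_right_inverse:
  fixes \<rho> :: "'j \<Rightarrow> 'y \<Rightarrow> real"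
  assumes \<rho>: "\<And>j. j \<in> J \<Longrightarrow> continuous_on C (\<rho> j)"
      "\<And>j. j \<in> J \<Longrightarrow> subadditive_on C (\<rho> j)"
      "\<And>j. j \<in> J \<Longrightarrow> pos_homogeneous_on C (\<rho> j)"
    and \<gamma>: "\<And>x. norm x = 1 \<Longrightarrow> \<gamma> x \<in> C" "\<And>x. norm x = 1 \<Longrightarrow> T (\<gamma> x) = x"
      "\<And>x. norm x = 1 \<Longrightarrow> norm (\<gamma> x) \<le> K"
      "\<And>x j. norm x = 1 \<Longrightarrow> j \<in> J \<Longrightarrow> \<rho> j (\<gamma> x) \<le> \<alpha> j"
    and \<delta>: "\<delta> > 0"
  obtains h where "continuous_on UNIV h" "pos_homogeneous_on UNIV h" "\<And>x. h x \<in> C"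
    "\<And>x. norm (h x) \<le> K * norm x" "\<And>x. norm (x - T (h x)) \<le> \<delta> * norm x"
    "\<And>x j. j \<in> J \<Longrightarrow> \<rho> j (h x) \<le> \<alpha> j * norm x"
proof -
  obtain g where g: "continuous_on (sphere 0 1) g"
    "\<And>x. x \<in> sphere 0 1 \<Longrightarrow> g x \<in> closure (convex hull (\<gamma> ` (sphere 0 1 \<inter> ball x \<delta>)))"
    by (rule continuous_local_averaging[of "sphere 0 1" \<gamma> K \<delta>]) (use \<gamma> \<delta> in auto)
  have g_in: "g x \<in> D" if x: "norm x = 1" and D: "closed D" "convex D"
    "\<And>y. norm y = 1 \<Longrightarrow> dist x y < \<delta> \<Longrightarrow> \<gamma> y \<in> D" for x D
  proof -
    have "closure (convex hull (\<gamma> ` (sphere 0 1 \<inter> ball x \<delta>))) \<subseteq> D"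
      by (intro closure_minimal hull_minimal) (use D in auto)
    then show ?thesis using g(2) x by auto
  qed
  have gC: "g x \<in> C" if "norm x = 1" for x
    by (rule g_in[OF that closed convex]) (use \<gamma> in auto)
  have gK: "norm (g x) \<le> K" if "norm x = 1" for x
    using g_in[OF that closed_cball convex_cball, of 0 K] \<gamma> by auto
  have gT: "dist x (T (g x)) \<le> \<delta>" if x: "norm x = 1" for x
  proof -
    have "closed {u \<in> C. T u \<in> cball x \<delta>}"
      using continuous_closed_preimage[OF cont closed closed_cball, of x \<delta>]
      by (simp add: vimage_def Int_def)
    then have "g x \<in> {u \<in> C. T u \<in> cball x \<delta>}"
      by (rule g_in[OF x _ convex_vimage]) (use \<gamma> in auto)
    then show ?thesis by simp
  qed
  have g\<rho>: "\<rho> j (g x) \<le> \<alpha> j" if x: "norm x = 1" and j: "j \<in> J" for x j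
  proof -
    have "closed {u \<in> C. \<rho> j u \<le> \<alpha> j}"
      using continuous_closed_preimage[OF \<rho>(1)[OF j] closed closed_atMost, of "\<alpha> j"]
      by (simp add: vimage_def Int_def)
    then have "g x \<in> {u \<in> C. \<rho> j u \<le> \<alpha> j}"
      by (rule g_in[OF x _ convex_sublevel[OF \<rho>(2,3)[OF j]]]) (use \<gamma> j in auto)
    then show ?thesis by simp
  qed
  let ?h = "\<lambda>x. norm x *\<^sub>R g (sgn x)"
  have \<rho>0: "\<rho> j 0 = 0" if "j \<in> J" for j
    using \<rho>(3)[OF that] zero_mem unfolding pos_homogeneous_on_def
    by (metis order_refl scaleR_zero_left)
  show thesis
  proof (rule that[of ?h])
    show "continuous_on UNIV ?h" by (rule continuous_on_radial_extension[OF g(1) gK])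
    show "pos_homogeneous_on UNIV ?h" by (rule pos_homogeneous_radial_extension)
    fix x :: 'x
    show "?h x \<in> C" by (cases "x = 0") (auto intro!: scale_mem gC simp: zero_mem norm_sgn)
    show "norm (?h x) \<le> K * norm x"
      using mult_left_mono[OF gK, of "sgn x" "norm x"]
      by (cases "x = 0") (auto simp: norm_sgn mult.commute)
    show "\<rho> j (?h x) \<le> \<alpha> j * norm x" if j: "j \<in> J" for j
    proof (cases "x = 0")
      case False
      then have "\<rho> j (?h x) = norm x * \<rho> j (g (sgn x))"
        using \<rho>(3)[OF j] gC by (simp add: pos_homogeneous_on_def norm_sgn)
      then show ?thesis
        using False mult_left_mono[OF g\<rho>[OF _ j], of "sgn x" "norm x"]
        by (simp add: norm_sgn mult.commute)
    qed (simp add: \<rho>0[OF j])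
    show "norm (x - T (?h x)) \<le> \<delta> * norm x"
    proof (cases "x = 0")
      case False
      then have "x - T (?h x) = norm x *\<^sub>R (sgn x - T (g (sgn x)))"
        by (simp add: map_scale gC norm_sgn scaleR_diff_right) (simp add: sgn_div_norm)
      then have "norm (x - T (?h x)) = norm x * dist (sgn x) (T (g (sgn x)))"
        by (simp add: dist_norm)
      then show ?thesis
        using False mult_left_mono[OF gT, of "sgn x" "norm x"]
        by (simp add: norm_sgn mult.commute)
    qed (simp add: map_zero)
  qed
qed

end

theorem proposition3p5:
  fixes C :: "'y::banach set"
    and T :: "'y \<Rightarrow> 'x::banach"
    and J :: "'j set"
    and \<rho> :: "'j \<Rightarrow> 'y \<Rightarrow> real"
  assumes "closed C" and "additive_cone C"
    and "T ` C = UNIV"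
    and "continuous_on C T"
    and "additive_on C T"
    and "pos_homogeneous_on C T"
    and "finite J"
    and "\<And>j. j \<in> J \<Longrightarrow> continuous_on C (\<rho> j)"
    and "\<And>j. j \<in> J \<Longrightarrow> subadditive_on C (\<rho> j)"
    and "\<And>j. j \<in> J \<Longrightarrow> pos_homogeneous_on C (\<rho> j)"
  shows
    "((\<forall>j\<in>J. bdd_above (\<rho> j ` (sphere 0 1 \<inter> C))) \<longrightarrow>
       (\<exists>(K::real) (\<alpha> :: 'j \<Rightarrow> real) (\<gamma> :: 'x \<Rightarrow> 'y).
          K > 0 \<and>
          \<gamma> ` sphere 0 1 \<subseteq> C \<and>
          (\<forall>x\<in>sphere 0 1. T (\<gamma> x) = x) \<and>
          (\<forall>x\<in>sphere 0 1. norm (\<gamma> x) \<le> K) \<and>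
          (\<forall>x\<in>sphere 0 1. \<forall>j\<in>J. \<rho> j (\<gamma> x) \<le> \<alpha> j)))
     \<and>
     (\<forall>(K::real) (\<alpha> :: 'j \<Rightarrow> real) (\<gamma> :: 'x \<Rightarrow> 'y).
          K > 0 \<and>
          \<gamma> ` sphere 0 1 \<subseteq> C \<and>
          (\<forall>x\<in>sphere 0 1. T (\<gamma> x) = x) \<and>
          (\<forall>x\<in>sphere 0 1. norm (\<gamma> x) \<le> K) \<and>
          (\<forall>x\<in>sphere 0 1. \<forall>j\<in>J. \<rho> j (\<gamma> x) \<le> \<alpha> j)
        \<longrightarrow>
          (\<forall>\<epsilon>>0. \<exists>\<gamma>\<^sub>\<epsilon> :: 'x \<Rightarrow> 'y.
             continuous_on UNIV \<gamma>\<^sub>\<epsilon> \<and>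
             pos_homogeneous_on UNIV \<gamma>\<^sub>\<epsilon> \<and>
             range \<gamma>\<^sub>\<epsilon> \<subseteq> C \<and>
             (\<forall>x. T (\<gamma>\<^sub>\<epsilon> x) = x) \<and>
             (\<forall>x. norm (\<gamma>\<^sub>\<epsilon> x) \<le> (K + \<epsilon>) * norm x) \<and>
             (\<forall>x. \<forall>j\<in>J. \<rho> j (\<gamma>\<^sub>\<epsilon> x) \<le> (\<alpha> j + \<epsilon>) * norm x)))"
proof (intro conjI impI allI, goal_cases)
  case 1
  interpret closed_cone_map C T
    using assms by unfold_locales auto
  obtain K \<gamma> where \<gamma>: "K > 0" "\<And>x. \<gamma> x \<in> C" "\<And>x. T (\<gamma> x) = x" "\<And>x. norm (\<gamma> x) \<le> K * norm x"
    using bounded_right_inverse[OF assms(3)] by metis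
  have "\<exists>b\<ge>0. \<forall>u\<in>C. \<rho> j u \<le> b * norm u" if "j \<in> J" for j
    using bounded_above_on_cone[OF assms(10)[OF that]] 1 that by metis
  then obtain b where b: "\<And>j. j \<in> J \<Longrightarrow> b j \<ge> 0" "\<And>j u. j \<in> J \<Longrightarrow> u \<in> C \<Longrightarrow> \<rho> j u \<le> b j * norm u"
    by metis
  have "norm (\<gamma> x) \<le> K" if "norm x = 1" for x using \<gamma>(4)[of x] that by simp
  moreover have "\<rho> j (\<gamma> x) \<le> b j * K" if "norm x = 1" "j \<in> J" for x j
    using b(2)[OF that(2) \<gamma>(2)[of x]] mult_left_mono[OF \<gamma>(4)[of x] b(1)[OF that(2)]] that(1) by simp
  ultimately show ?case
    using \<gamma> by (intro exI[of _ K] exI[of _ "\<lambda>j. b j * K"] exI[of _ \<gamma>]) auto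
next
  case (2 K \<alpha> \<gamma> \<epsilon>)
  interpret closed_cone_map C T
    using assms by unfold_locales auto
  \<comment> \<open>\<open>M\<close> dominates \<open>K\<close> and every \<open>\<bar>\<alpha> j\<bar>\<close>. The series multiplies them by \<open>\<delta> / (1 - \<delta>)\<close> to give
    the loss in the bounds, and \<open>\<delta>\<close> solves \<open>\<delta> / (1 - \<delta>) = \<epsilon> / M\<close>.\<close>
  define M where "M = K + (\<Sum>j\<in>J. \<bar>\<alpha> j\<bar>)"
  have K: "K > 0" "K \<le> M" using 2 by (auto simp: M_def sum_nonneg)
  have \<alpha>: "\<bar>\<alpha> j\<bar> \<le> M" if "j \<in> J" for j
    using member_le_sum[of j J "\<lambda>j. \<bar>\<alpha> j\<bar>"] that assms(7) K(1) by (simp add: M_def)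
  define \<delta> where "\<delta> = \<epsilon> / (M + \<epsilon>)"
  have "1 - \<delta> = M / (M + \<epsilon>)"
    using 2 K by (simp add: \<delta>_def field_simps)
  then have quot: "c / (1 - \<delta>) = c * (M + \<epsilon>) / M" for c
    by simp
  have \<delta>: "\<delta> > 0" "\<delta> < 1" "\<delta> / (1 - \<delta>) = \<epsilon> / M"
    unfolding quot using 2 K by (simp_all add: \<delta>_def)
  have K_quot: "K / (1 - \<delta>) = K + K * (\<epsilon> / M)"
    unfolding quot using K by (simp add: distrib_left add_divide_distrib)
  have small: "c * (\<epsilon> / M) \<le> \<epsilon>" if "c \<le> M" for c
    using that 2 K by (simp add: field_simps)
  obtain h where h: "continuous_on UNIV h" "pos_homogeneous_on UNIV h" "\<And>x. h x \<in> C"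
    "\<And>x. norm (h x) \<le> K * norm x" "\<And>x. norm (x - T (h x)) \<le> \<delta> * norm x"
    "\<And>x j. j \<in> J \<Longrightarrow> \<rho> j (h x) \<le> \<alpha> j * norm x"
    by (rule continuous_approximate_right_inverse[of J \<rho> \<gamma> K \<alpha> \<delta>])
      (use 2 assms(8-10) \<delta>(1) in \<open>auto simp: image_subset_iff\<close>)
  interpret approximate_right_inverse C T h K \<delta>
    by unfold_locales (use h K \<delta> in auto)
  have bound: "norm (exact_inverse x) \<le> (K + \<epsilon>) * norm x" for x
    by (rule order_trans[OF exact_inverse_bound mult_right_mono])
      (use small[OF K(2)] K_quot in auto)
  have "\<rho> j (exact_inverse x) \<le> (\<alpha> j + \<epsilon>) * norm x" if j: "j \<in> J" for x j
    by (rule order_trans[OF exact_inverse_subadditive_bound[OF assms(8-10)[OF j] h(6)[OF j]]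
          mult_right_mono])
      (use small[OF \<alpha>[OF j]] \<delta>(3) in auto)
  then show ?case
    using continuous_exact_inverse[OF h(1)] exact_inverse_homogeneous[OF h(2)]
      exact_inverse_mem map_exact_inverse bound
    by (intro exI[of _ exact_inverse]) auto
qed

end
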